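(* Let $\mathcal{G}=(\mathcal{V},\mathcal{E})$ be a connected finite undirected graph with $\mathcal{V}=\{1,\dots,n\}$ and neighbor sets $\mathbf{N}_i$. For each edge between $i$ and $j$ let $\alpha_{ij}=\alpha_{ji}>0$ and $\beta_{ij}=-\beta_{ji}\in\mathbb{R}$, and let $p_i^g,p_i^d\in\mathbb{R}$ satisfy $\sum_{i=1}^n p_i^g=\sum_{i=1}^n p_i^d$. Let $\mathcal{L}_{\mathcal{G}}$ be the weighted Laplacian with edge weights $\frac{1}{4\alpha_{ij}}$, and let $\mathbf{w}\in\mathbb{R}^n$ have entries $$w_i=-\sum_{j\in\mathbf{N}_i}\frac{\beta_{ij}}{2\alpha_{ij}}+(p_i^g-p_i^d).$$ Then every solution $\lambda^v(t)\in\mathbb{R}^n$, $t\ge0$, of $$\dot\lambda^v=-\mathcal{L}_{\mathcal{G}}\lambda^v+\mathbf{w}$$ converges as $t\to\infty$ to a constant vector ${\lambda^v}^\ast$, and this limit is a solution of $\mathcal{L}_{\mathcal{G}}\lambda^v-\mathbf{w}=0$.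
   Context: The weighted Laplacian is $\mathcal{L}_{\mathcal{G}}=D_{\mathcal{G}}-A_{\mathcal{G}}$, where $A_{\mathcal{G}}(i,j)=\frac{1}{4\alpha_{ij}}$ if $i,j$ are adjacent and $0$ otherwise, and $D_{\mathcal{G}}$ is diagonal with $D_{\mathcal{G}}(i,i)=\sum_{j\in\mathbf{N}_i}A_{\mathcal{G}}(i,j)$. Here $p_i^g$ is the energy generated at node $i$ and $p_i^d$ the desired energy; the condition $\sum_i p_i^g=\sum_i p_i^d$ is the supply-demand balance. *)

theory Defs
  imports "HOL-Analysis.Analysis" "Graph_Theory.Digraph_Component"
begin

text \<open>
  Undirected graphs are finite symmetric loop-free digraphs (locale \<open>pair_graph\<close>): an edge between
  \<open>i\<close> and \<open>j\<close> is the pair of arcs \<open>(i, j)\<close>, \<open>(j, i)\<close>. The vertex set is a whole finite type, so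
  that vertices index the components of vectors in \<open>real ^ 'n\<close>.
\<close>

definition neighbors :: "'n pair_pre_digraph \<Rightarrow> 'n \<Rightarrow> 'n set" where
  "neighbors G i = {j. (i, j) \<in> parcs G}"

definition weighted_adjacency ::
    "'n::finite pair_pre_digraph \<Rightarrow> ('n \<Rightarrow> 'n \<Rightarrow> real) \<Rightarrow> real ^ 'n ^ 'n" where
  "weighted_adjacency G \<alpha> = (\<chi> i j. if j \<in> neighbors G i then 1 / (4 * \<alpha> i j) else 0)"

definition weighted_degree ::
    "'n::finite pair_pre_digraph \<Rightarrow> ('n \<Rightarrow> 'n \<Rightarrow> real) \<Rightarrow> real ^ 'n ^ 'n" where
  "weighted_degree G \<alpha> =
     (\<chi> i j. if i = j then \<Sum>k\<in>neighbors G i. weighted_adjacency G \<alpha> $ i $ k else 0)"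

definition weighted_laplacian ::
    "'n::finite pair_pre_digraph \<Rightarrow> ('n \<Rightarrow> 'n \<Rightarrow> real) \<Rightarrow> real ^ 'n ^ 'n" where
  "weighted_laplacian G \<alpha> = weighted_degree G \<alpha> - weighted_adjacency G \<alpha>"

definition source_vector ::
    "'n::finite pair_pre_digraph \<Rightarrow> ('n \<Rightarrow> 'n \<Rightarrow> real) \<Rightarrow> ('n \<Rightarrow> 'n \<Rightarrow> real) \<Rightarrow>
     real ^ 'n \<Rightarrow> real ^ 'n \<Rightarrow> real ^ 'n" where
  "source_vector G \<alpha> \<beta> p\<^sub>g p\<^sub>d =
     (\<chi> i. - (\<Sum>j\<in>neighbors G i. \<beta> i j / (2 * \<alpha> i j)) + (p\<^sub>g $ i - p\<^sub>d $ i))"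

end

theory Submission
  imports Defs
begin

text \<open>
  The Laplacian \<open>L\<close> is symmetric with quadratic form
  \<open>x \<bullet> L x = 1/2 * (\<Sum>i j. A i j * (x i - x j)^2)\<close>, and it annihilates and is orthogonal to constant
  vectors. For a connected graph the form vanishes only on constants, so \<open>L + J\<close>, with \<open>J\<close> the
  all-ones matrix, is positive definite. By antisymmetry of \<open>\<beta>\<close> and the balance condition the entries
  of \<open>w\<close> sum to 0, so along a solution the sum \<open>s\<close> of the entries is conserved. Solving
  \<open>(L + J) x = w + s *\<^sub>R 1\<close> gives the solution of \<open>L x = w\<close> with entry sum \<open>s\<close>. The deviation \<open>y\<close>
  from it has entry sum 0, hence \<open>y' = - (L + J) y\<close>, which decays exponentially.
\<close>

text \<open>The quadratic form is continuous and the unit sphere is compact, so it attains a minimum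
  there, which is positive. That minimum serves as \<open>c\<close>; homogeneity of degree 2 carries
  the bound to all vectors.\<close>

lemma positive_definite_coercive:
  fixes f :: "'a::euclidean_space \<Rightarrow> 'a"
  assumes "linear f" and pos: "\<And>x. x \<noteq> 0 \<Longrightarrow> 0 < x \<bullet> f x"
  obtains c where "c > 0" "\<And>x. c * (x \<bullet> x) \<le> x \<bullet> f x"
proof -
  have "compact (sphere 0 1 :: 'a set)" by simp
  moreover have "sphere 0 1 \<noteq> ({} :: 'a set)" by simp
  moreover have "continuous_on (sphere 0 1) (\<lambda>x. x \<bullet> f x)"
    using assms(1) by (intro continuous_intros linear_continuous_on) (simp add: linear_conv_bounded_linear)
  ultimately obtain u where u: "u \<in> sphere 0 1" "\<And>x. x \<in> sphere 0 1 \<Longrightarrow> u \<bullet> f u \<le> x \<bullet> f x"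
    using continuous_attains_inf by metis
  have "(u \<bullet> f u) * (x \<bullet> x) \<le> x \<bullet> f x" for x
  proof (cases "x = 0")
    case False
    let ?v = "x /\<^sub>R norm x"
    have "u \<bullet> f u \<le> ?v \<bullet> f ?v" using False by (intro u) simp
    also have "\<dots> = (x \<bullet> f x) / (norm x)^2"
      by (simp add: linear_cmul[OF assms(1)] power2_eq_square divide_simps)
    finally show ?thesis using False by (simp add: dot_square_norm field_simps)
  qed simp
  moreover have "u \<bullet> f u > 0" using u(1) by (intro pos) auto
  ultimately show ?thesis using that by blast
qed

text \<open>Along the flow the squared norm has derivative \<open>- 2 * (y \<bullet> f y)\<close>,
  at most \<open>- 2 * c\<close> times itself. The integrating factor \<open>exp (2 * c * t)\<close>
  in \<open>V\<close> compensates exactly this rate, so \<open>V\<close> is nonincreasing and the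
  squared norm is at most \<open>V 0 * exp (- (2 * c * t))\<close>.\<close>

lemma coercive_flow_tendsto_zero:
  fixes f :: "'a::real_inner \<Rightarrow> 'a"
  assumes "c > 0" and coercive: "\<And>x. c * (x \<bullet> x) \<le> x \<bullet> f x"
    and deriv: "\<And>t. t \<ge> 0 \<Longrightarrow> (y has_vector_derivative - f (y t)) (at t within {0..})"
  shows "(y \<longlongrightarrow> 0) at_top"
proof -
  define V where "V t = exp (2 * c * t) * (y t \<bullet> y t)" for t
  let ?V' = "\<lambda>t. 2 * exp (2 * c * t) * (c * (y t \<bullet> y t) - y t \<bullet> f (y t))"
  have V': "(V has_real_derivative ?V' t) (at t within {0..})" if "t \<ge> 0" for t
  proof -
    have inner: "((\<lambda>t. y t \<bullet> y t) has_real_derivative - 2 * (y t \<bullet> f (y t))) (at t within {0..})"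
      using has_derivative_inner[OF deriv[OF that, unfolded has_vector_derivative_def]
          deriv[OF that, unfolded has_vector_derivative_def]]
      unfolding has_field_derivative_def
      by (rule has_derivative_eq_rhs) (auto simp: inner_commute algebra_simps)
    have exp: "((\<lambda>t. exp (2 * c * t)) has_real_derivative 2 * c * exp (2 * c * t)) (at t within {0..})"
      by (auto intro!: derivative_eq_intros)
    show ?thesis unfolding V_def
      by (rule DERIV_cong[OF DERIV_mult[OF exp inner]]) (simp add: algebra_simps)
  qed
  have decay: "V t \<le> V 0" if "t \<ge> 0" for t
  \<comment> \<open>The derivative within \<open>{0..}\<close> is two-sided only at positive times,
    so the sign of \<open>V'\<close> is used on the open interval and the endpoint 0 is reached by
    continuity.\<close>
  proof (rule DERIV_nonpos_imp_decreasing_open[where f = V, OF that])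
    fix s assume "0 < s" "s < t"
    then have "at s within {0..} = at s"
      by (intro at_within_interior) simp
    with V'[of s] \<open>0 < s\<close> have "(V has_real_derivative ?V' s) (at s)"
      by (metis less_imp_le)
    moreover have "?V' s \<le> 0" using coercive[of "y s"] by (simp add: mult_nonneg_nonpos)
    ultimately show "\<exists>d. (V has_real_derivative d) (at s) \<and> d \<le> 0" by blast
  next
    have "continuous_on {0..} V"
      using V' by (auto simp: continuous_on_eq_continuous_within intro: DERIV_continuous)
    then show "continuous_on {0..t} V" by (rule continuous_on_subset) auto
  qed
  have "((\<lambda>t. y t \<bullet> y t) \<longlongrightarrow> 0) at_top"
  proof (rule tendsto_sandwich[where f = "\<lambda>_. 0"])
    show "\<forall>\<^sub>F t in at_top. y t \<bullet> y t \<le> V 0 * exp (- (2 * c * t))"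
      using eventually_ge_at_top[of 0]
      by eventually_elim (use decay in \<open>simp add: V_def exp_minus field_simps\<close>)
    have "filterlim (\<lambda>t. 2 * c * t) at_top at_top"
      using \<open>c > 0\<close> by (intro filterlim_tendsto_pos_mult_at_top[OF tendsto_const]) (auto simp: filterlim_ident)
    then have "((\<lambda>t. exp (- (2 * c * t))) \<longlongrightarrow> 0) at_top"
      by (intro filterlim_compose[OF exp_at_bot] filterlim_compose[OF filterlim_uminus_at_bot_at_top])
    then show "((\<lambda>t. V 0 * exp (- (2 * c * t))) \<longlongrightarrow> 0) at_top"
      by (rule tendsto_mult_right_zero)
  qed auto
  then have "((\<lambda>t. sqrt (y t \<bullet> y t)) \<longlongrightarrow> sqrt 0) at_top" by (rule tendsto_real_sqrt)
  then show ?thesis by (simp add: norm_eq_sqrt_inner[symmetric] tendsto_norm_zero_iff)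
qed

text \<open>Swapping the order of summation turns the sum into its own negative.\<close>

lemma double_sum_antisymmetric_eq_0:
  fixes f :: "'a \<Rightarrow> 'a \<Rightarrow> real"
  assumes "\<And>i j. f i j = - f j i"
  shows "(\<Sum>i\<in>S. \<Sum>j\<in>S. f i j) = 0"
proof -
  have "(\<Sum>i\<in>S. \<Sum>j\<in>S. f i j) = (\<Sum>i\<in>S. \<Sum>j\<in>S. - f j i)"
    by (intro sum.cong refl assms)
  also have "\<dots> = - (\<Sum>i\<in>S. \<Sum>j\<in>S. f i j)"
    by (subst sum.swap) (simp add: sum_negf)
  finally show ?thesis by simp
qed

text \<open>With both indices ranging over the whole type, sums over edges become double sums whose
  order can be swapped.\<close>

lemma sum_neighbors: "(\<Sum>j\<in>neighbors G i. f j) = (\<Sum>j\<in>UNIV. if j \<in> neighbors G i then f j else 0)"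
  for f :: "'n::finite \<Rightarrow> real"
  by (simp add: sum.If_cases)

text \<open>The form in differences makes the contributions of an edge to its two endpoints opposite
  when the weights are symmetric, which drives the two lemmas that follow.\<close>

lemma weighted_laplacian_mult_nth:
  "(weighted_laplacian G \<alpha> *v x) $ i = (\<Sum>j\<in>UNIV. weighted_adjacency G \<alpha> $ i $ j * (x $ i - x $ j))"
proof -
  have "weighted_degree G \<alpha> $ i $ j = (if i = j then \<Sum>k\<in>UNIV. weighted_adjacency G \<alpha> $ i $ k else 0)" for j
    unfolding weighted_degree_def sum_neighbors by (auto simp: weighted_adjacency_def intro!: sum.cong)
  then have "(weighted_laplacian G \<alpha> *v x) $ i
      = (\<Sum>j\<in>UNIV. (if i = j then \<Sum>k\<in>UNIV. weighted_adjacency G \<alpha> $ i $ k else 0) * x $ j)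
        - (\<Sum>j\<in>UNIV. weighted_adjacency G \<alpha> $ i $ j * x $ j)"
    by (simp add: weighted_laplacian_def matrix_vector_mult_def left_diff_distrib sum_subtractf)
  also have "(\<Sum>j\<in>UNIV. (if i = j then \<Sum>k\<in>UNIV. weighted_adjacency G \<alpha> $ i $ k else 0) * x $ j)
      = (\<Sum>k\<in>UNIV. weighted_adjacency G \<alpha> $ i $ k) * x $ i"
    by (simp add: if_distrib[of "\<lambda>u. u * _"] cong: if_cong)
  finally show ?thesis by (simp add: sum_distrib_right right_diff_distrib sum_subtractf)
qed

lemma sum_weighted_laplacian_mult:
  assumes sym: "\<And>i j. weighted_adjacency G \<alpha> $ i $ j = weighted_adjacency G \<alpha> $ j $ i"
  shows "(\<Sum>i\<in>UNIV. (weighted_laplacian G \<alpha> *v x) $ i) = 0"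
  unfolding weighted_laplacian_mult_nth
  by (rule double_sum_antisymmetric_eq_0) (simp add: sym algebra_simps)

lemma weighted_laplacian_quadratic_form:
  assumes sym: "\<And>i j. weighted_adjacency G \<alpha> $ i $ j = weighted_adjacency G \<alpha> $ j $ i"
  shows "2 * (x \<bullet> (weighted_laplacian G \<alpha> *v x))
    = (\<Sum>i\<in>UNIV. \<Sum>j\<in>UNIV. weighted_adjacency G \<alpha> $ i $ j * (x $ i - x $ j)^2)"
proof -
  let ?a = "\<lambda>i j. weighted_adjacency G \<alpha> $ i $ j"
  have "x \<bullet> (weighted_laplacian G \<alpha> *v x) = (\<Sum>i\<in>UNIV. \<Sum>j\<in>UNIV. ?a i j * (x $ i * (x $ i - x $ j)))"
    by (simp add: inner_vec_def weighted_laplacian_mult_nth sum_distrib_left mult_ac)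
  \<comment> \<open>Each summand equals the weight times \<open>(x $ i)^2 - (x $ j)^2\<close>, which
    is antisymmetric in \<open>i\<close> and \<open>j\<close>.\<close>
  moreover have "(\<Sum>i\<in>UNIV. \<Sum>j\<in>UNIV. 2 * (?a i j * (x $ i * (x $ i - x $ j))) - ?a i j * (x $ i - x $ j)^2) = 0"
    by (rule double_sum_antisymmetric_eq_0) (simp add: sym algebra_simps power2_eq_square)
  ultimately show ?thesis by (simp add: sum_subtractf sum_distrib_left)
qed

text \<open>Connectedness means reachability in the symmetric closure, so equality propagates by
  induction along a path; a reversed arc is harmless because equality is symmetric.\<close>

lemma connected_imp_constant:
  assumes "Digraph_Component.connected (with_proj G)" and "pverts G = UNIV"
    and step: "\<And>i j. (i, j) \<in> parcs G \<Longrightarrow> x i = x j"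
  shows "x i = x j"
proof -
  have "i \<rightarrow>\<^sup>*\<^bsub>with_proj (mk_symmetric (with_proj G))\<^esub> j"
    using assms(1,2) by (auto simp: connected_def strongly_connected_def)
  then have "(i, j) \<in> (parcs (mk_symmetric (with_proj G)))\<^sup>*"
    using reachable_rtranclI by fastforce
  then show ?thesis
    by induction (auto simp: parcs_mk_symmetric dest!: step)
qed

text \<open>The terms \<open>\<beta> i j / (2 * \<alpha> i j)\<close> cancel in pairs over the two
  directions of each edge, and what is left vanishes by the supply-demand balance.\<close>

lemma sum_source_vector_eq_0:
  assumes "\<And>i j. j \<in> neighbors G i \<Longrightarrow> i \<in> neighbors G j"
    and "\<And>i j. j \<in> neighbors G i \<Longrightarrow> \<alpha> i j = \<alpha> j i \<and> \<beta> i j = - \<beta> j i"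
    and "(\<Sum>i\<in>UNIV. p $ i) = (\<Sum>i\<in>UNIV. q $ i)"
  shows "(\<Sum>i\<in>UNIV. source_vector G \<alpha> \<beta> p q $ i) = 0"
proof -
  have "(if j \<in> neighbors G i then \<beta> i j / (2 * \<alpha> i j) else 0)
      = - (if i \<in> neighbors G j then \<beta> j i / (2 * \<alpha> j i) else 0)" for i j
    using assms(1)[of j i] assms(1)[of i j] assms(2)[of j i] by auto
  then have "(\<Sum>i\<in>UNIV. \<Sum>j\<in>neighbors G i. \<beta> i j / (2 * \<alpha> i j)) = 0"
    unfolding sum_neighbors by (rule double_sum_antisymmetric_eq_0)
  with assms(3) show ?thesis
    by (simp add: source_vector_def sum.distrib sum_subtractf sum_negf)
qed

theorem mainTheorem2:
  fixes G :: "'n::finite pair_pre_digraph"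
    and \<alpha> \<beta> :: "'n \<Rightarrow> 'n \<Rightarrow> real"
    and p\<^sub>g p\<^sub>d :: "real ^ 'n"
    and lam :: "real \<Rightarrow> real ^ 'n"
  assumes "pair_graph G"
    and "pverts G = UNIV"
    and "Digraph_Component.connected (with_proj G)"
    and "\<And>i j. (i, j) \<in> parcs G \<Longrightarrow> \<alpha> i j = \<alpha> j i \<and> \<alpha> i j > 0"
    and "\<And>i j. (i, j) \<in> parcs G \<Longrightarrow> \<beta> i j = - \<beta> j i"
    and "(\<Sum>i\<in>UNIV. p\<^sub>g $ i) = (\<Sum>i\<in>UNIV. p\<^sub>d $ i)"
    and "\<And>t. t \<ge> 0 \<Longrightarrow>
           (lam has_vector_derivative
             (- (weighted_laplacian G \<alpha> *v lam t) + source_vector G \<alpha> \<beta> p\<^sub>g p\<^sub>d))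
           (at t within {0..})"
  shows "\<exists>lam_star. (lam \<longlongrightarrow> lam_star) at_top \<and>
           weighted_laplacian G \<alpha> *v lam_star - source_vector G \<alpha> \<beta> p\<^sub>g p\<^sub>d = 0"
proof -
  define A where "A = weighted_adjacency G \<alpha>"
  define L where "L = weighted_laplacian G \<alpha>"
  define w where "w = source_vector G \<alpha> \<beta> p\<^sub>g p\<^sub>d"
  define S where "S x = (\<Sum>i\<in>UNIV. x $ i)" for x :: "real ^ 'n"
  \<comment> \<open>All entries of J x equal \<open>S x\<close>, so this is the map L + J.\<close>
  define M where "M x = L *v x + S x *\<^sub>R 1" for x
  interpret pair_graph G by fact
  have nbr_sym: "i \<in> neighbors G j" if "j \<in> neighbors G i" for i j
    using that arcs_symmetric by (simp add: neighbors_def)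
  have A_sym: "A $ i $ j = A $ j $ i" for i j
    using nbr_sym[of i j] nbr_sym[of j i] assms(4)[of i j]
    by (auto simp: A_def weighted_adjacency_def neighbors_def)
  have A_nonneg: "A $ i $ j \<ge> 0" for i j
    using assms(4)[of i j] by (auto simp: A_def weighted_adjacency_def neighbors_def)
  have A_pos: "A $ i $ j > 0" if "(i, j) \<in> parcs G" for i j
    using assms(4)[OF that] that by (auto simp: A_def weighted_adjacency_def neighbors_def)
  have S_L: "S (L *v x) = 0" for x
    using sum_weighted_laplacian_mult A_sym unfolding S_def L_def A_def by blast
  have S_w: "S w = 0"
    unfolding S_def w_def
  proof (rule sum_source_vector_eq_0)
    show "\<alpha> i j = \<alpha> j i \<and> \<beta> i j = - \<beta> j i" if "j \<in> neighbors G i" for i j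
      using that assms(4,5)[of i j] unfolding neighbors_def by blast
  qed (use nbr_sym assms(6) in auto)
  have lin_S: "bounded_linear S"
    unfolding S_def by (intro bounded_linear_sum bounded_linear_vec_nth)
  note S_simps = linear_add[OF bounded_linear.linear[OF lin_S]] linear_diff[OF bounded_linear.linear[OF lin_S]]
    linear_neg[OF bounded_linear.linear[OF lin_S]] linear_cmul[OF bounded_linear.linear[OF lin_S]]
  have S_one: "S 1 = CARD('n)" by (simp add: S_def)
  have lin_M: "linear M"
    by (rule linearI)
      (simp_all add: M_def S_simps matrix_vector_right_distrib matrix_vector_mult_scaleR algebra_simps)
  have form: "2 * (x \<bullet> (L *v x)) = (\<Sum>i\<in>UNIV. \<Sum>j\<in>UNIV. A $ i $ j * (x $ i - x $ j)^2)" for x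
    using weighted_laplacian_quadratic_form A_sym unfolding L_def A_def by blast
  \<comment> \<open>The form is \<open>x \<bullet> (L *v x) + (S x)^2\<close>, with both terms
    nonnegative. If it is not positive, both vanish: the first makes \<open>x\<close> constant
    across every edge, hence constant, and the second then makes that constant 0.\<close>
  have M_pos: "0 < x \<bullet> M x" if "x \<noteq> 0" for x
  proof (rule ccontr)
    assume "\<not> 0 < x \<bullet> M x"
    moreover have "x \<bullet> 1 = S x" by (simp add: S_def inner_vec_def)
    then have "x \<bullet> M x = x \<bullet> (L *v x) + (S x)^2"
      by (simp add: M_def inner_add_right power2_eq_square)
    moreover have "x \<bullet> (L *v x) \<ge> 0"
    proof -
      have "0 \<le> (\<Sum>i\<in>UNIV. \<Sum>j\<in>UNIV. A $ i $ j * (x $ i - x $ j)^2)"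
        by (intro sum_nonneg) (simp add: A_nonneg)
      with form[of x] show ?thesis by linarith
    qed
    ultimately have "x \<bullet> (L *v x) = 0" and S0: "S x = 0"
      using zero_le_power2[of "S x"] by (smt (verit) power2_eq_square mult_eq_0_iff)+
    then have "\<forall>i j. A $ i $ j * (x $ i - x $ j)^2 = 0"
      using form[of x] by (simp add: sum_nonneg_eq_0_iff sum_nonneg A_nonneg)
    then have "x $ i = x $ j" if "(i, j) \<in> parcs G" for i j
      using A_pos[OF that] by (metis mult_eq_0_iff less_irrefl power_eq_0_iff right_minus_eq)
    then have const: "x $ i = x $ j" for i j
      using connected_imp_constant[OF assms(3,2), of "($) x"] by blast
    have "S x = CARD('n) * x $ j" for j
    proof -
      have "S x = (\<Sum>i\<in>(UNIV :: 'n set). x $ j)"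
        unfolding S_def by (intro sum.cong refl const)
      then show ?thesis by simp
    qed
    with S0 have "x = 0" by (simp add: vec_eq_iff)
    with that show False by simp
  qed
  \<comment> \<open>Positive definiteness gives a trivial kernel, and in finite dimension
    injectivity yields surjectivity.\<close>
  have "inj M"
    using M_pos lin_M by (auto simp: linear_injective_0 intro: ccontr) (metis inner_zero_right less_irrefl)
  then have "surj M" using lin_M linear_injective_imp_surjective by blast
  then obtain z where z: "M z = w + S (lam 0) *\<^sub>R 1" by (metis surjD)
  \<comment> \<open>Summing entries kills \<open>L *v z\<close> and \<open>w\<close> and leaves
    \<open>CARD('n) * S z = CARD('n) * S (lam 0)\<close>. The multiples of 1 in \<open>z\<close>
    then cancel, so the limit candidate solves the original equation.\<close>
  from arg_cong[OF z, of S] have S_z: "S z = S (lam 0)"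
    by (simp add: M_def S_simps S_L S_w S_one)
  with z have L_z: "L *v z = w" by (simp add: M_def)
  \<comment> \<open>The derivative of the sum is \<open>S\<close> of the right-hand side of the
    equation, and both of its summands have entry sum 0.\<close>
  have S_const: "S (lam t) = S (lam 0)" if "t \<ge> 0" for t
  proof -
    have "((\<lambda>t. S (lam t)) has_derivative (\<lambda>h. 0)) (at s within {0..})" if "s \<in> {0..}" for s
    proof -
      have "((\<lambda>t. S (lam t)) has_vector_derivative S (- (L *v lam s) + w)) (at s within {0..})"
        using assms(7)[of s] that unfolding L_def w_def
        by (intro bounded_linear.has_vector_derivative[OF lin_S]) auto
      then show ?thesis by (simp add: S_simps S_L S_w has_vector_derivative_def)
    qed
    then show ?thesis
      using has_derivative_zero_unique[of "{0..}" "\<lambda>t. S (lam t)" 0 t] that by simp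
  qed
  obtain c where c: "c > 0" "\<And>x. c * (x \<bullet> x) \<le> x \<bullet> M x"
    using positive_definite_coercive[OF lin_M M_pos] by blast
  have "((\<lambda>t. lam t - z) \<longlongrightarrow> 0) at_top"
  proof (rule coercive_flow_tendsto_zero[OF c])
    fix t :: real assume t: "t \<ge> 0"
    \<comment> \<open>Since \<open>lam t\<close> and \<open>z\<close> have the same entry sum, the J
      part of \<open>M\<close> vanishes on the deviation; this is where conservation of the sum
      enters.\<close>
    have "- M (lam t - z) = - (L *v lam t) + w"
      by (simp add: M_def S_simps S_const[OF t] S_z matrix_vector_mult_diff_distrib L_z)
    then show "((\<lambda>t. lam t - z) has_vector_derivative - M (lam t - z)) (at t within {0..})"
      using assms(7)[OF t] by (simp add: has_vector_derivative_diff_const L_def w_def)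
  qed
  then have "(lam \<longlongrightarrow> z) at_top" by (rule LIM_zero_cancel)
  with L_z show ?thesis unfolding L_def w_def by auto
qed

end
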